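(* Let $\mathcal{X}$ be a finite set, let $\pi$ be a probability measure on $\mathcal{X}$ with strictly positive masses, let $P\in\mathcal{L}(\pi)$, and let $\mathcal{X}=\bigsqcup_{i=1}^k\mathcal{O}_i$ be a partition into $k\ge 2$ non-empty sets, with associated Gibbs kernel $G$ and projection chain $\overline{P}$. Then for every $l\in\mathbb{N}$, $$D_{\mathrm{KL}}^\pi\left((GPG)^l\,\|\,\Pi\right)=D_{\mathrm{KL}}^{\overline{\pi}}\left(\overline{P}^l\,\|\,\overline{\Pi}\right)\le\left(1-\alpha\left(\overline{P}^2\right)\right)^lH(\overline{\pi}).$$
   Context: $\mathbb{N}=\{1,2,\dots\}$. $\mathcal{L}(\pi)$ is the set of transition matrices $P$ on $\mathcal{X}$ that are $\pi$-reversible: $\pi(x)P(x,y)=\pi(y)P(y,x)$ for all $x,y$. The Gibbs kernel is $G(x,y)=\pi(y)/\pi(\mathcal{O}(x))$ if $y\in\mathcal{O}(x)$ and $0$ otherwise, where $\mathcal{O}(x)$ is the block containing $x$ and $\pi(A)=\sum_{z\in A}\pi(z)$. $\Pi$ is the matrix all of whose rows equal $\pi$. The projection chain is the $k\times k$ transition matrix $\overline{P}(i,j)=\frac{1}{\pi(\mathcal{O}_i)}\sum_{x\in\mathcal{O}_i,\,y\in\mathcal{O}_j}\pi(x)P(x,y)$, with stationary distribution $\overline{\pi}=(\pi(\mathcal{O}_1),\dots,\pi(\mathcal{O}_k))$; $\overline{\Pi}$ is the $k\times k$ matrix all of whose rows equal $\overline{\pi}$; $\overline{P}^2=\overline{P}\,\overline{P}$.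 For a strictly positive probability measure $\mu$ on a finite set and $\mu$-stationary transition matrices $A,B$, $D^\mu_{\mathrm{KL}}(A\|B)=\sum_{x,y}\mu(x)A(x,y)\log\frac{A(x,y)}{B(x,y)}$, with $0\log(0/a)=0$. Shannon entropy: $H(\mu)=-\sum_x\mu(x)\log\mu(x)$. The log-Sobolev constant of a $\mu$-stationary transition matrix $Q$ is $$\alpha(Q)=\inf\left\{\frac{\langle(I-Q)f,f\rangle_\mu}{\mathscr{L}(f)}:\ f \text{ real-valued},\ \mathscr{L}(f)\ne0\right\},\qquad \mathscr{L}(f)=\sum_x|f(x)|^2\log\left(\frac{|f(x)|^2}{\|f\|_\mu^2}\right)\mu(x),$$ where $\langle f,g\rangle_\mu=\sum_xf(x)g(x)\mu(x)$ and $\|f\|_\mu^2=\langle f,f\rangle_\mu$ (for $\alpha(\overline{P}^2)$, take $\mu=\overline{\pi}$). *)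

theory Defs
  imports "HOL-Analysis.Analysis"
begin

text \<open>The state space is a finite type; a measure is the vector of its point masses, and a
  transition matrix \<open>P\<close> has \<open>P $ x $ y\<close> as the probability of moving from \<open>x\<close> to \<open>y\<close>.\<close>

definition positive_prob_vec :: "real ^ 'n::finite \<Rightarrow> bool" where
  "positive_prob_vec \<mu> \<longleftrightarrow> (\<forall>x. 0 < \<mu> $ x) \<and> (\<Sum>x\<in>UNIV. \<mu> $ x) = 1"

definition transition_matrix :: "real ^ 'n::finite ^ 'n \<Rightarrow> bool" where
  "transition_matrix P \<longleftrightarrow> (\<forall>x y. 0 \<le> P $ x $ y) \<and> (\<forall>x. (\<Sum>y\<in>UNIV. P $ x $ y) = 1)"

definition reversible_matrices :: "real ^ 'n::finite \<Rightarrow> (real ^ 'n ^ 'n) set" where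
  "reversible_matrices \<mu> =
     {P. transition_matrix P \<and> (\<forall>x y. \<mu> $ x * P $ x $ y = \<mu> $ y * P $ y $ x)}"

text \<open>The operation \<open>^\<close> inherited from the ring structure on vectors is componentwise, so
  powers with respect to the matrix product \<open>**\<close> are introduced separately.\<close>

primrec matrix_power :: "real ^ 'n::finite ^ 'n \<Rightarrow> nat \<Rightarrow> real ^ 'n ^ 'n" where
  "matrix_power A 0 = mat 1"
| "matrix_power A (Suc l) = A ** matrix_power A l"

definition stationary_matrix :: "real ^ 'n::finite \<Rightarrow> real ^ 'n ^ 'n" where
  "stationary_matrix \<mu> = (\<chi> x y. \<mu> $ y)"

definition mass :: "real ^ 'n::finite \<Rightarrow> 'n set \<Rightarrow> real" where
  "mass \<mu> A = (\<Sum>z\<in>A. \<mu> $ z)"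

text \<open>A partition into \<open>k\<close> blocks is a family indexed by a finite type \<open>'k\<close> with \<open>k\<close>
  elements; nonemptiness and disjointness make the indexing injective.\<close>

definition block_partition :: "('k::finite \<Rightarrow> 'n::finite set) \<Rightarrow> bool" where
  "block_partition B \<longleftrightarrow> (\<forall>i. B i \<noteq> {}) \<and> disjoint_family B \<and> (\<Union>i. B i) = UNIV"

definition block_of :: "('k::finite \<Rightarrow> 'n::finite set) \<Rightarrow> 'n \<Rightarrow> 'n set" where
  "block_of B x = B (THE i. x \<in> B i)"

definition gibbs_kernel ::
    "real ^ 'n::finite \<Rightarrow> ('k::finite \<Rightarrow> 'n set) \<Rightarrow> real ^ 'n ^ 'n" where
  "gibbs_kernel \<mu> B =
     (\<chi> x y. if y \<in> block_of B x then \<mu> $ y / mass \<mu> (block_of B x) else 0)"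

definition projected_matrix ::
    "real ^ 'n::finite \<Rightarrow> ('k::finite \<Rightarrow> 'n set) \<Rightarrow> real ^ 'n ^ 'n \<Rightarrow> real ^ 'k ^ 'k" where
  "projected_matrix \<mu> B P =
     (\<chi> i j. 1 / mass \<mu> (B i) * (\<Sum>x\<in>B i. \<Sum>y\<in>B j. \<mu> $ x * P $ x $ y))"

definition projected_vec ::
    "real ^ 'n::finite \<Rightarrow> ('k::finite \<Rightarrow> 'n set) \<Rightarrow> real ^ 'k" where
  "projected_vec \<mu> B = (\<chi> i. mass \<mu> (B i))"

text \<open>Since \<open>0 * ln (0 / a) = 0\<close>, the convention for vanishing entries of \<open>A\<close> is
  automatic. The real-valued formula is the divergence only if \<open>A $ x $ y = 0\<close> whenever
  \<open>B $ x $ y = 0\<close>; this holds in particular if \<open>B\<close> is the matrix with all rows equal to a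
  strictly positive \<open>\<mu>\<close>.\<close>

definition KL_div :: "real ^ 'n::finite \<Rightarrow> real ^ 'n ^ 'n \<Rightarrow> real ^ 'n ^ 'n \<Rightarrow> real" where
  "KL_div \<mu> A B =
     (\<Sum>x\<in>UNIV. \<Sum>y\<in>UNIV. \<mu> $ x * A $ x $ y * ln (A $ x $ y / B $ x $ y))"

definition shannon_entropy :: "real ^ 'n::finite \<Rightarrow> real" where
  "shannon_entropy \<mu> = - (\<Sum>x\<in>UNIV. \<mu> $ x * ln (\<mu> $ x))"

definition weighted_inner :: "real ^ 'n::finite \<Rightarrow> real ^ 'n \<Rightarrow> real ^ 'n \<Rightarrow> real" where
  "weighted_inner \<mu> f g = (\<Sum>x\<in>UNIV. f $ x * g $ x * \<mu> $ x)"

definition entropy_functional :: "real ^ 'n::finite \<Rightarrow> real ^ 'n \<Rightarrow> real" where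
  "entropy_functional \<mu> f =
     (\<Sum>x\<in>UNIV. \<bar>f $ x\<bar>\<^sup>2 * ln (\<bar>f $ x\<bar>\<^sup>2 / weighted_inner \<mu> f f) * \<mu> $ x)"

text \<open>For strictly positive \<open>\<mu>\<close> and \<open>\<mu>\<close>-stationary transition matrices \<open>Q\<close> the quotients are nonnegative, and
  they form a nonempty set as soon as there are at least two states; so the real infimum
  is then a genuine one.\<close>

definition log_sobolev :: "real ^ 'n::finite \<Rightarrow> real ^ 'n ^ 'n \<Rightarrow> real" where
  "log_sobolev \<mu> Q =
     Inf {weighted_inner \<mu> ((mat 1 - Q) *v f) f / entropy_functional \<mu> f | f.
            entropy_functional \<mu> f \<noteq> 0}"

end

theory Submission
  imports Defs
begin

text \<open>The kernel \<open>GPG\<close> factors through the blocks: \<open>(GPG)\<^sup>l(x,y)\<close> is \<open>Pbar\<^sup>l\<close> between the blocks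
  of \<open>x\<close> and \<open>y\<close>, times the conditional mass of \<open>y\<close> in its block; this gives the equality.

  For the bound, the columns of \<open>Q\<^sup>l\<close> divided by the stationary mass are densities \<open>f\<close>, and passing
  from \<open>l\<close> to \<open>l + 1\<close> replaces \<open>f\<close> by \<open>Q f\<close>. A probability measure satisfies
  \<open>Ent(f) \<ge> Var(sqrt f)\<close>; applying this to every row of \<open>Q\<close> and integrating shows that the
  entropy drops by at least the Dirichlet form of \<open>Q\<^sup>2\<close> at \<open>sqrt f\<close>, hence by at least \<open>\<alpha>(Q\<^sup>2) Ent(f)\<close>
  (Miclo's argument). At \<open>l = 0\<close> the divergence is the Shannon entropy.\<close>

section \<open>Entropy and variance of the square root\<close>

text \<open>The variance around the mean \<open>a\<close> is nonnegative; expanding its square gives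
  the claim.\<close>

lemma square_mean_le_mean_square:
  fixes w g :: "'a \<Rightarrow> real"
  assumes "\<And>x. x \<in> A \<Longrightarrow> 0 \<le> w x" and "sum w A = 1"
  shows "(\<Sum>x\<in>A. w x * g x)\<^sup>2 \<le> (\<Sum>x\<in>A. w x * (g x)\<^sup>2)"
proof -
  define a where "a = (\<Sum>x\<in>A. w x * g x)"
  have "0 \<le> (\<Sum>x\<in>A. w x * (g x - a)\<^sup>2)"
    using assms by (intro sum_nonneg) auto
  also have "\<dots> = (\<Sum>x\<in>A. w x * (g x)\<^sup>2 - 2 * a * (w x * g x) + a\<^sup>2 * w x)"
    by (intro sum.cong refl) (simp add: power2_eq_square algebra_simps)
  also have "\<dots> = (\<Sum>x\<in>A. w x * (g x)\<^sup>2) - 2 * a * a + a\<^sup>2 * 1"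
    unfolding sum.distrib sum_subtractf sum_distrib_left[symmetric] a_def[symmetric] assms(2) ..
  finally show ?thesis
    by (simp add: a_def power2_eq_square)
qed

text \<open>Put \<open>s = sqrt m\<close>. The bound \<open>ln u \<le> u - 1\<close> at
  \<open>u = s / g x\<close> gives a pointwise lower bound for the summands, and these bounds add up
  to \<open>2 * m - 2 * s * a\<close>.\<close>

lemma entropy_ge_variance:
  fixes w g :: "'a \<Rightarrow> real"
  assumes w: "\<And>x. x \<in> A \<Longrightarrow> 0 \<le> w x"
    and g: "\<And>x. x \<in> A \<Longrightarrow> 0 \<le> g x"
  defines "m \<equiv> (\<Sum>x\<in>A. w x * (g x)\<^sup>2)"
  shows "m - (\<Sum>x\<in>A. w x * g x)\<^sup>2 \<le> (\<Sum>x\<in>A. w x * (g x)\<^sup>2 * ln ((g x)\<^sup>2 / m))"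
proof (cases "m = 0")
  case True
  \<comment> \<open>Here \<open>t / 0 = 0\<close> and \<open>ln 0 = 0\<close> make the right side
    vanish, while the left side is minus a square.\<close>
  then show ?thesis by simp
next
  case False
  define a where "a = (\<Sum>x\<in>A. w x * g x)"
  define s where "s = sqrt m"
  have "0 \<le> m" unfolding m_def using w by (intro sum_nonneg) auto
  then have s: "0 < s" "s\<^sup>2 = m" using False by (auto simp: s_def)
  \<comment> \<open>The two sides differ by exactly \<open>(s - a)\<^sup>2\<close>.\<close>
  have "m - a\<^sup>2 \<le> 2 * m - 2 * s * a"
    using zero_le_power2[of "s - a"] s(2) by (simp add: power2_eq_square algebra_simps)
  also have "\<dots> = (\<Sum>x\<in>A. w x * (2 * (g x)\<^sup>2 - 2 * s * g x))"
    by (simp add: m_def a_def algebra_simps sum_subtractf sum_distrib_left)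
  also have "\<dots> \<le> (\<Sum>x\<in>A. w x * ((g x)\<^sup>2 * ln ((g x)\<^sup>2 / m)))"
  proof (intro sum_mono mult_left_mono w)
    fix x assume x: "x \<in> A"
    show "2 * (g x)\<^sup>2 - 2 * s * g x \<le> (g x)\<^sup>2 * ln ((g x)\<^sup>2 / m)"
    proof (cases "g x = 0")
      case False
      then have gx: "0 < g x" using g[OF x] by simp
      have "ln (s / g x) \<le> s / g x - 1"
        using gx s(1) by (intro ln_le_minus_one) simp
      moreover have "ln ((g x)\<^sup>2 / m) = - 2 * ln (s / g x)"
        using gx s(1) by (simp add: s(2)[symmetric] ln_div ln_realpow)
      ultimately have "2 - 2 * (s / g x) \<le> ln ((g x)\<^sup>2 / m)" by simp
      then have "(g x)\<^sup>2 * (2 - 2 * (s / g x)) \<le> (g x)\<^sup>2 * ln ((g x)\<^sup>2 / m)"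
        by (intro mult_left_mono) auto
      moreover have "(g x)\<^sup>2 * (2 - 2 * (s / g x)) = 2 * (g x)\<^sup>2 - 2 * s * g x"
        using gx by (simp add: power2_eq_square field_simps)
      ultimately show ?thesis by simp
    qed simp
  qed
  finally show ?thesis by (simp add: a_def mult.assoc)
qed

text \<open>Wherever \<open>w x * f x\<close> is nonzero, both \<open>f x\<close> and
  \<open>m\<close> are positive, so the logarithm splits. With a row of \<open>Q\<close> as weights,
  the two resulting terms are \<open>Q\<close> applied to \<open>f ln f\<close>, and
  \<open>t ln t\<close> at the row mean of \<open>f\<close>.\<close>

lemma sum_mult_ln_divide:
  fixes w f :: "'a \<Rightarrow> real"
  assumes fin: "finite A" and w: "\<And>x. x \<in> A \<Longrightarrow> 0 \<le> w x" and f: "\<And>x. x \<in> A \<Longrightarrow> 0 \<le> f x"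
  defines "m \<equiv> (\<Sum>x\<in>A. w x * f x)"
  shows "(\<Sum>x\<in>A. w x * f x * ln (f x / m)) = (\<Sum>x\<in>A. w x * f x * ln (f x)) - m * ln m"
proof -
  have "w x * f x * ln (f x / m) = w x * f x * ln (f x) - w x * f x * ln m" if x: "x \<in> A" for x
  proof (cases "w x * f x = 0")
    case True
    then show ?thesis by (simp only: mult_zero_left)
  next
    case False
    have pos: "0 < w x * f x" using False w[OF x] f[OF x] by simp
    also have "\<dots> \<le> m"
      unfolding m_def using w f x fin by (intro member_le_sum) auto
    finally have "0 < m" .
    moreover have "0 < f x" using pos f[OF x] by (cases "f x = 0") auto
    ultimately show ?thesis by (simp add: ln_div algebra_simps)
  qed
  then have "(\<Sum>x\<in>A. w x * f x * ln (f x / m))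
      = (\<Sum>x\<in>A. w x * f x * ln (f x) - w x * f x * ln m)"
    by (intro sum.cong) auto
  then show ?thesis by (simp add: sum_subtractf sum_distrib_right m_def)
qed

section \<open>Entropy decay for reversible matrices\<close>

text \<open>The entropy dominates the variance of \<open>\<bar>f\<bar>\<close>; absolute values are
  taken because the variance bound asks for a nonnegative function.\<close>

lemma entropy_functional_nonneg:
  fixes \<mu> f :: "real ^ 'n::finite"
  assumes "positive_prob_vec \<mu>"
  shows "0 \<le> entropy_functional \<mu> f"
proof -
  have \<mu>: "\<And>x. 0 \<le> \<mu> $ x" "(\<Sum>x\<in>UNIV. \<mu> $ x) = 1"
    using assms by (auto simp: positive_prob_vec_def less_imp_le)
  have m: "weighted_inner \<mu> f f = (\<Sum>x\<in>UNIV. \<mu> $ x * \<bar>f $ x\<bar>\<^sup>2)"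
    unfolding weighted_inner_def by (simp add: power2_eq_square mult_ac)
  have "0 \<le> (\<Sum>x\<in>UNIV. \<mu> $ x * \<bar>f $ x\<bar>\<^sup>2) - (\<Sum>x\<in>UNIV. \<mu> $ x * \<bar>f $ x\<bar>)\<^sup>2"
    using square_mean_le_mean_square[of UNIV "($) \<mu>" "\<lambda>x. \<bar>f $ x\<bar>"] \<mu> by simp
  also have "\<dots> \<le> (\<Sum>x\<in>UNIV. \<mu> $ x * \<bar>f $ x\<bar>\<^sup>2 * ln (\<bar>f $ x\<bar>\<^sup>2 / weighted_inner \<mu> f f))"
    unfolding m using \<mu> by (intro entropy_ge_variance) auto
  also have "\<dots> = entropy_functional \<mu> f"
    by (simp add: entropy_functional_def mult_ac)
  finally show ?thesis .
qed

section \<open>Stationarity, the Dirichlet form of \<open>Q ** Q\<close> and its log-Sobolev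
  inequality\<close>

lemma reversible_stationary:
  assumes "Q \<in> reversible_matrices \<mu>"
  shows "(\<Sum>x\<in>UNIV. \<mu> $ x * (Q *v f) $ x) = (\<Sum>x\<in>UNIV. \<mu> $ x * f $ x)"
proof -
  have rev: "\<mu> $ x * Q $ x $ y = \<mu> $ y * Q $ y $ x" and row: "(\<Sum>y\<in>UNIV. Q $ x $ y) = 1" for x y
    using assms by (auto simp: reversible_matrices_def transition_matrix_def)
  have "(\<Sum>x\<in>UNIV. \<mu> $ x * (Q *v f) $ x) = (\<Sum>x\<in>UNIV. \<Sum>y\<in>UNIV. \<mu> $ x * Q $ x $ y * f $ y)"
    by (simp add: matrix_vector_mult_def sum_distrib_left mult.assoc)
  also have "\<dots> = (\<Sum>y\<in>UNIV. \<Sum>x\<in>UNIV. \<mu> $ x * Q $ x $ y * f $ y)"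
    by (rule sum.swap)
  \<comment> \<open>Detailed balance turns the weighted column sum into a row sum, which equals
    1.\<close>
  also have "\<dots> = (\<Sum>y\<in>UNIV. \<Sum>x\<in>UNIV. (\<mu> $ y * f $ y) * Q $ y $ x)"
    by (intro sum.cong refl) (simp add: rev[of _ y for y] mult_ac)
  also have "\<dots> = (\<Sum>y\<in>UNIV. \<mu> $ y * f $ y)"
    by (simp add: row flip: sum_distrib_left)
  finally show ?thesis .
qed

text \<open>Reversibility makes \<open>Q\<close> self-adjoint for the weighted inner product, so one
  factor of \<open>Q ** Q\<close> moves to the other argument.\<close>

lemma dirichlet_form_square:
  assumes "Q \<in> reversible_matrices \<mu>"
  shows "weighted_inner \<mu> ((mat 1 - Q ** Q) *v g) g
    = weighted_inner \<mu> g g - weighted_inner \<mu> (Q *v g) (Q *v g)"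
proof -
  have rev: "\<mu> $ x * Q $ x $ y = \<mu> $ y * Q $ y $ x" for x y
    using assms by (auto simp: reversible_matrices_def)
  have adj: "weighted_inner \<mu> (Q *v h) g = weighted_inner \<mu> h (Q *v g)" for h
  proof -
    have "weighted_inner \<mu> (Q *v h) g
        = (\<Sum>x\<in>UNIV. \<Sum>y\<in>UNIV. (\<mu> $ x * Q $ x $ y) * h $ y * g $ x)"
      by (simp add: weighted_inner_def matrix_vector_mult_def sum_distrib_left sum_distrib_right mult_ac)
    also have "\<dots> = (\<Sum>x\<in>UNIV. \<Sum>y\<in>UNIV. (\<mu> $ y * Q $ y $ x) * h $ y * g $ x)"
      by (subst rev) (rule refl)
    also have "\<dots> = (\<Sum>y\<in>UNIV. \<Sum>x\<in>UNIV. (\<mu> $ y * Q $ y $ x) * h $ y * g $ x)"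
      by (rule sum.swap)
    also have "\<dots> = weighted_inner \<mu> h (Q *v g)"
      by (simp add: weighted_inner_def matrix_vector_mult_def sum_distrib_left sum_distrib_right mult_ac)
    finally show ?thesis .
  qed
  have "weighted_inner \<mu> ((mat 1 - Q ** Q) *v g) g
      = weighted_inner \<mu> g g - weighted_inner \<mu> (Q *v (Q *v g)) g"
    by (simp add: matrix_vector_mult_diff_rdistrib matrix_vector_mul_assoc weighted_inner_def
        left_diff_distrib sum_subtractf)
  then show ?thesis by (simp add: adj)
qed

text \<open>Row by row, the square of the mean is at most the mean of the square; stationarity then
  removes \<open>Q\<close> from the integral of \<open>g\<^sup>2\<close>.\<close>

lemma dirichlet_form_square_nonneg:
  assumes "positive_prob_vec \<mu>" and Q: "Q \<in> reversible_matrices \<mu>"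
  shows "0 \<le> weighted_inner \<mu> ((mat 1 - Q ** Q) *v g) g"
proof -
  have \<mu>: "\<And>x. 0 \<le> \<mu> $ x"
    using assms by (auto simp: positive_prob_vec_def less_imp_le)
  have row: "\<And>x y. 0 \<le> Q $ x $ y" "\<And>x. (\<Sum>y\<in>UNIV. Q $ x $ y) = 1"
    using Q by (auto simp: reversible_matrices_def transition_matrix_def)
  have "weighted_inner \<mu> (Q *v g) (Q *v g) = (\<Sum>x\<in>UNIV. \<mu> $ x * (\<Sum>y\<in>UNIV. Q $ x $ y * g $ y)\<^sup>2)"
    by (simp add: weighted_inner_def matrix_vector_mult_def power2_eq_square mult_ac)
  also have "\<dots> \<le> (\<Sum>x\<in>UNIV. \<mu> $ x * (\<Sum>y\<in>UNIV. Q $ x $ y * (g $ y)\<^sup>2))"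
    using \<mu> row by (intro sum_mono mult_left_mono square_mean_le_mean_square) auto
  also have "\<dots> = (\<Sum>x\<in>UNIV. \<mu> $ x * (Q *v (\<chi> y. (g $ y)\<^sup>2)) $ x)"
    by (simp add: matrix_vector_mult_def)
  also have "\<dots> = weighted_inner \<mu> g g"
    unfolding reversible_stationary[OF Q] by (simp add: weighted_inner_def power2_eq_square mult_ac)
  finally show ?thesis by (simp add: dirichlet_form_square[OF Q])
qed

text \<open>The infimum lies below each of its quotients because they are bounded below by 0. For
  zero entropy no quotient is available, and nonnegativity of the Dirichlet form suffices.\<close>

lemma log_sobolev_square_le:
  assumes "positive_prob_vec \<mu>" and Q: "Q \<in> reversible_matrices \<mu>"
  shows "log_sobolev \<mu> (Q ** Q) * entropy_functional \<mu> g
    \<le> weighted_inner \<mu> ((mat 1 - Q ** Q) *v g) g"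
proof (cases "entropy_functional \<mu> g = 0")
  case True
  then show ?thesis using dirichlet_form_square_nonneg[OF assms] by simp
next
  case False
  then have pos: "0 < entropy_functional \<mu> g"
    using entropy_functional_nonneg[OF assms(1), of g] by simp
  have "log_sobolev \<mu> (Q ** Q)
      \<le> weighted_inner \<mu> ((mat 1 - Q ** Q) *v g) g / entropy_functional \<mu> g"
    unfolding log_sobolev_def
  proof (rule cInf_lower)
    show "bdd_below {weighted_inner \<mu> ((mat 1 - Q ** Q) *v f) f / entropy_functional \<mu> f | f.
        entropy_functional \<mu> f \<noteq> 0}"
      using dirichlet_form_square_nonneg[OF assms] entropy_functional_nonneg[OF assms(1)]
      by (intro bdd_belowI[of _ 0]) auto
  qed (use False in blast)
  then show ?thesis using pos by (simp add: pos_le_divide_eq)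
qed

lemma entropy_contraction:
  fixes \<mu> f :: "real ^ 'n::finite"
  assumes pos: "positive_prob_vec \<mu>" and Q: "Q \<in> reversible_matrices \<mu>"
    and f: "\<And>x. 0 \<le> f $ x" and f1: "(\<Sum>x\<in>UNIV. \<mu> $ x * f $ x) = 1"
  shows "(\<Sum>x\<in>UNIV. \<mu> $ x * ((Q *v f) $ x * ln ((Q *v f) $ x)))
    \<le> (1 - log_sobolev \<mu> (Q ** Q)) * (\<Sum>x\<in>UNIV. \<mu> $ x * (f $ x * ln (f $ x)))"
proof -
  have \<mu>: "\<And>x. 0 \<le> \<mu> $ x"
    using pos by (auto simp: positive_prob_vec_def less_imp_le)
  have row: "\<And>x y. 0 \<le> Q $ x $ y" "\<And>x. (\<Sum>y\<in>UNIV. Q $ x $ y) = 1"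
    using Q by (auto simp: reversible_matrices_def transition_matrix_def)
  define g where "g = (\<chi> x. sqrt (f $ x))"
  define F where "F = (\<chi> x. f $ x * ln (f $ x))"
  have g2: "(g $ x)\<^sup>2 = f $ x" "0 \<le> g $ x" for x using f by (auto simp: g_def)
  have wg: "weighted_inner \<mu> g g = (\<Sum>x\<in>UNIV. \<mu> $ x * f $ x)"
    by (simp add: weighted_inner_def mult_ac flip: g2 power2_eq_square)
  have ent: "entropy_functional \<mu> g = (\<Sum>x\<in>UNIV. \<mu> $ x * F $ x)"
    unfolding entropy_functional_def wg f1 by (simp add: F_def g2 mult_ac)
  \<comment> \<open>The variance bound for the weights \<open>Q $ x $ y\<close>: since
    \<open>g\<^sup>2 = f\<close>, the mean square is \<open>(Q *v f) $ x\<close>.\<close>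
  have rowwise: "(Q *v f) $ x - ((Q *v g) $ x)\<^sup>2
      \<le> (Q *v F) $ x - (Q *v f) $ x * ln ((Q *v f) $ x)" for x
    using entropy_ge_variance[of UNIV "\<lambda>y. Q $ x $ y" "\<lambda>y. g $ y"]
      sum_mult_ln_divide[of UNIV "\<lambda>y. Q $ x $ y" "\<lambda>y. f $ y"] row f
    by (simp add: g2 matrix_vector_mult_def F_def mult.assoc)
  have "weighted_inner \<mu> ((mat 1 - Q ** Q) *v g) g
      = (\<Sum>x\<in>UNIV. \<mu> $ x * (Q *v f) $ x) - (\<Sum>x\<in>UNIV. \<mu> $ x * ((Q *v g) $ x)\<^sup>2)"
    unfolding dirichlet_form_square[OF Q] wg reversible_stationary[OF Q]
    by (simp add: weighted_inner_def power2_eq_square mult_ac)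
  also have "\<dots> = (\<Sum>x\<in>UNIV. \<mu> $ x * ((Q *v f) $ x - ((Q *v g) $ x)\<^sup>2))"
    by (simp add: right_diff_distrib sum_subtractf)
  also have "\<dots> \<le> (\<Sum>x\<in>UNIV. \<mu> $ x * ((Q *v F) $ x - (Q *v f) $ x * ln ((Q *v f) $ x)))"
    using \<mu> rowwise by (intro sum_mono mult_left_mono) auto
  \<comment> \<open>Stationarity applied to \<open>F\<close> recovers the entropy before the step,
    so the bound is the entropy drop.\<close>
  also have "\<dots> = (\<Sum>x\<in>UNIV. \<mu> $ x * F $ x)
      - (\<Sum>x\<in>UNIV. \<mu> $ x * ((Q *v f) $ x * ln ((Q *v f) $ x)))"
    by (simp add: right_diff_distrib sum_subtractf reversible_stationary[OF Q])
  finally have "(\<Sum>x\<in>UNIV. \<mu> $ x * ((Q *v f) $ x * ln ((Q *v f) $ x)))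
      \<le> (\<Sum>x\<in>UNIV. \<mu> $ x * F $ x) - weighted_inner \<mu> ((mat 1 - Q ** Q) *v g) g"
    by simp
  also have "\<dots> \<le> (\<Sum>x\<in>UNIV. \<mu> $ x * F $ x)
      - log_sobolev \<mu> (Q ** Q) * (\<Sum>x\<in>UNIV. \<mu> $ x * F $ x)"
    using log_sobolev_square_le[OF pos Q, of g] by (simp add: ent)
  finally show ?thesis by (simp add: F_def left_diff_distrib)
qed

section \<open>Densities of the powers and the decay of the divergence\<close>

definition column_density :: "real ^ 'n::finite \<Rightarrow> real ^ 'n ^ 'n \<Rightarrow> nat \<Rightarrow> 'n \<Rightarrow> real ^ 'n" where
  "column_density \<mu> Q l y = (\<chi> x. matrix_power Q l $ x $ y / \<mu> $ y)"

text \<open>Powers grow by multiplication on the left, which acts on each column separately; this is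
  why columns are used.\<close>

lemma column_density_Suc: "column_density \<mu> Q (Suc l) y = Q *v column_density \<mu> Q l y"
  by (simp add: column_density_def vec_eq_iff matrix_vector_mult_def matrix_matrix_mult_def
      sum_divide_distrib)

lemma column_density_nonneg:
  assumes "positive_prob_vec \<mu>" and "Q \<in> reversible_matrices \<mu>"
  shows "0 \<le> column_density \<mu> Q l y $ x"
proof (induction l arbitrary: x)
  case 0
  then show ?case
    using assms by (auto simp: column_density_def mat_def positive_prob_vec_def less_imp_le)
next
  case (Suc l)
  then show ?case
    using assms unfolding column_density_Suc matrix_vector_mult_def
    by (auto simp: reversible_matrices_def transition_matrix_def intro!: sum_nonneg)
qed

lemma column_density_integral:
  assumes "positive_prob_vec \<mu>" and "Q \<in> reversible_matrices \<mu>"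
  shows "(\<Sum>x\<in>UNIV. \<mu> $ x * column_density \<mu> Q l y $ x) = 1"
proof (induction l)
  case 0
  have "\<mu> $ y \<noteq> 0"
    using assms(1) by (simp add: positive_prob_vec_def less_imp_neq[symmetric])
  then show ?case
    by (simp add: column_density_def mat_def if_distrib[of "\<lambda>t. t / _"] if_distrib[of "(*) _"] cong: if_cong)
next
  case (Suc l)
  then show ?case
    by (simp add: column_density_Suc reversible_stationary[OF assms(2)])
qed

text \<open>Writing each entry as \<open>\<mu> $ y\<close> times a density makes the divergence a
  \<open>\<mu>\<close>-average over \<open>y\<close> of entropies of single functions, to which
  \<open>entropy_contraction\<close> applies.\<close>

lemma KL_div_column_density:
  assumes "positive_prob_vec \<mu>"
  shows "KL_div \<mu> (matrix_power Q l) (stationary_matrix \<mu>)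
    = (\<Sum>y\<in>UNIV. \<mu> $ y * (\<Sum>x\<in>UNIV. \<mu> $ x *
        (column_density \<mu> Q l y $ x * ln (column_density \<mu> Q l y $ x))))"
proof -
  have "\<mu> $ y \<noteq> 0" for y
    using assms by (simp add: positive_prob_vec_def less_imp_neq[symmetric])
  then have "KL_div \<mu> (matrix_power Q l) (stationary_matrix \<mu>)
    = (\<Sum>x\<in>UNIV. \<Sum>y\<in>UNIV. \<mu> $ y * (\<mu> $ x *
        (column_density \<mu> Q l y $ x * ln (column_density \<mu> Q l y $ x))))"
    unfolding KL_div_def by (simp add: column_density_def stationary_matrix_def mult_ac)
  also have "\<dots> = (\<Sum>y\<in>UNIV. \<Sum>x\<in>UNIV. \<mu> $ y * (\<mu> $ x *
        (column_density \<mu> Q l y $ x * ln (column_density \<mu> Q l y $ x))))"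
    by (rule sum.swap)
  finally show ?thesis by (simp add: sum_distrib_left)
qed

lemma KL_div_power_nonneg:
  assumes "positive_prob_vec \<mu>" and "Q \<in> reversible_matrices \<mu>"
  shows "0 \<le> KL_div \<mu> (matrix_power Q l) (stationary_matrix \<mu>)"
proof -
  have \<mu>: "\<And>x. 0 \<le> \<mu> $ x"
    using assms by (auto simp: positive_prob_vec_def less_imp_le)
  have "0 \<le> (\<Sum>x\<in>UNIV. \<mu> $ x * (column_density \<mu> Q l y $ x * ln (column_density \<mu> Q l y $ x)))" for y
  proof -
    define f where "f = column_density \<mu> Q l y"
    define g where "g = (\<chi> x. sqrt (f $ x))"
    have f: "0 \<le> f $ x" for x
      unfolding f_def by (rule column_density_nonneg[OF assms])
    \<comment> \<open>The density has integral 1, so the normalisation inside the logarithm of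
      \<open>entropy_functional\<close> disappears.\<close>
    have "weighted_inner \<mu> g g = 1"
      using column_density_integral[OF assms, of l y] f
      by (simp add: weighted_inner_def g_def f_def[symmetric] mult_ac)
    then have "entropy_functional \<mu> g = (\<Sum>x\<in>UNIV. \<mu> $ x * (f $ x * ln (f $ x)))"
      using f by (simp add: entropy_functional_def g_def mult_ac)
    then show ?thesis
      using entropy_functional_nonneg[OF assms(1), of g] by (simp add: f_def)
  qed
  then show ?thesis
    unfolding KL_div_column_density[OF assms(1)] using \<mu> by (intro sum_nonneg) (rule mult_nonneg_nonneg)
qed

lemma KL_div_power_Suc:
  assumes "positive_prob_vec \<mu>" and "Q \<in> reversible_matrices \<mu>"
  shows "KL_div \<mu> (matrix_power Q (Suc l)) (stationary_matrix \<mu>)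
    \<le> (1 - log_sobolev \<mu> (Q ** Q)) * KL_div \<mu> (matrix_power Q l) (stationary_matrix \<mu>)"
proof -
  have \<mu>: "\<And>x. 0 \<le> \<mu> $ x"
    using assms by (auto simp: positive_prob_vec_def less_imp_le)
  define E where "E f = (\<Sum>x\<in>UNIV. \<mu> $ x * (f $ x * ln (f $ x)))" for f :: "real ^ 'a"
  have "(\<Sum>y\<in>UNIV. \<mu> $ y * E (column_density \<mu> Q (Suc l) y))
    \<le> (\<Sum>y\<in>UNIV. \<mu> $ y * ((1 - log_sobolev \<mu> (Q ** Q)) * E (column_density \<mu> Q l y)))"
    unfolding column_density_Suc E_def
    by (intro sum_mono mult_left_mono \<mu> entropy_contraction[OF assms]
        column_density_nonneg[OF assms] column_density_integral[OF assms])
  then show ?thesis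
    unfolding KL_div_column_density[OF assms(1)] E_def[symmetric]
    by (simp add: sum_distrib_left mult_ac)
qed

lemma KL_div_mat_1:
  assumes "positive_prob_vec \<mu>"
  shows "KL_div \<mu> (mat 1) (stationary_matrix \<mu>) = shannon_entropy \<mu>"
proof -
  have \<mu>: "0 < \<mu> $ x" for x
    using assms by (auto simp: positive_prob_vec_def)
  have "(\<Sum>y\<in>UNIV. \<mu> $ x * mat 1 $ x $ y * ln (mat 1 $ x $ y / stationary_matrix \<mu> $ x $ y))
      = (\<Sum>y\<in>UNIV. if y = x then - (\<mu> $ x * ln (\<mu> $ x)) else 0)" for x
    using \<mu> by (intro sum.cong) (auto simp: mat_def stationary_matrix_def ln_div)
  then show ?thesis
    by (simp add: KL_div_def shannon_entropy_def sum_negf)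
qed

text \<open>A second state forces every mass strictly below 1, so each summand is positive. This
  later permits division by the entropy.\<close>

lemma shannon_entropy_pos:
  fixes \<mu> :: "real ^ 'n::finite"
  assumes "positive_prob_vec \<mu>" and "CARD('n) \<ge> 2"
  shows "0 < shannon_entropy \<mu>"
proof -
  have \<mu>: "0 < \<mu> $ x" and s: "(\<Sum>x\<in>UNIV. \<mu> $ x) = 1" for x
    using assms by (auto simp: positive_prob_vec_def)
  have lt1: "\<mu> $ x < 1" for x
  proof -
    obtain y where y: "y \<noteq> x"
    proof -
      have "UNIV \<noteq> {x}"
      proof
        assume "UNIV = {x}"
        then have "CARD('n) = card {x}" by simp
        then show False using assms(2) by simp
      qed
      then show thesis using that by blast
    qed
    have "\<mu> $ x < \<mu> $ x + \<mu> $ y" using \<mu> by simp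
    also have "\<dots> = (\<Sum>z\<in>{x, y}. \<mu> $ z)" using y by simp
    also have "\<dots> \<le> (\<Sum>z\<in>UNIV. \<mu> $ z)"
      using \<mu> by (intro sum_mono2) (auto simp: less_imp_le)
    finally show ?thesis using s by simp
  qed
  have "0 < (\<Sum>x\<in>UNIV. - (\<mu> $ x * ln (\<mu> $ x)))"
    using \<mu> lt1 by (intro sum_pos) (auto simp: mult_pos_neg)
  then show ?thesis by (simp add: shannon_entropy_def sum_negf)
qed

lemma KL_div_power_le:
  fixes \<mu> :: "real ^ 'n::finite"
  assumes pos: "positive_prob_vec \<mu>" and Q: "Q \<in> reversible_matrices \<mu>" and card: "CARD('n) \<ge> 2"
  shows "KL_div \<mu> (matrix_power Q l) (stationary_matrix \<mu>)
    \<le> (1 - log_sobolev \<mu> (Q ** Q)) ^ l * shannon_entropy \<mu>"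
proof -
  define c where "c = 1 - log_sobolev \<mu> (Q ** Q)"
  \<comment> \<open>The induction multiplies by \<open>c\<close> and so needs
    \<open>0 \<le> c\<close>. The divergence at exponent 1 is nonnegative and at most
    \<open>c\<close> times the one at exponent 0, which is the entropy.\<close>
  have "0 \<le> c * shannon_entropy \<mu>"
    using KL_div_power_nonneg[OF pos Q, of "Suc 0"] KL_div_power_Suc[OF pos Q, of 0]
    by (simp add: KL_div_mat_1[OF pos] c_def)
  then have c: "0 \<le> c"
    using shannon_entropy_pos[OF pos card] by (simp add: zero_le_mult_iff)
  have "KL_div \<mu> (matrix_power Q l) (stationary_matrix \<mu>) \<le> c ^ l * shannon_entropy \<mu>"
  proof (induction l)
    case 0
    then show ?case by (simp add: KL_div_mat_1[OF pos])
  next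
    case (Suc l)
    have "KL_div \<mu> (matrix_power Q (Suc l)) (stationary_matrix \<mu>)
        \<le> c * KL_div \<mu> (matrix_power Q l) (stationary_matrix \<mu>)"
      unfolding c_def by (rule KL_div_power_Suc[OF pos Q])
    also have "\<dots> \<le> c * (c ^ l * shannon_entropy \<mu>)"
      using Suc c by (rule mult_left_mono)
    finally show ?case by (simp add: mult.assoc)
  qed
  then show ?thesis by (simp add: c_def)
qed

section \<open>Projection onto the blocks\<close>

text \<open>Names the description hidden in \<open>block_of\<close>, so that block membership
  becomes an equation between indices.\<close>

definition block_index :: "('k::finite \<Rightarrow> 'n::finite set) \<Rightarrow> 'n \<Rightarrow> 'k" where
  "block_index B x = (THE i. x \<in> B i)"

lemma mem_block_iff:
  assumes "block_partition B"
  shows "x \<in> B i \<longleftrightarrow> block_index B x = i"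
proof -
  have disj: "\<And>i j. x \<in> B i \<Longrightarrow> x \<in> B j \<Longrightarrow> i = j"
    using assms by (auto simp: block_partition_def disjoint_family_on_def)
  have "x \<in> (\<Union>i. B i)"
    using assms by (simp add: block_partition_def)
  then obtain j where j: "x \<in> B j" by blast
  then have "block_index B x = j"
    unfolding block_index_def using disj by blast
  then show ?thesis using j disj by auto
qed

lemma sum_blocks:
  fixes h :: "'n::finite \<Rightarrow> real"
  assumes "block_partition (B :: 'k::finite \<Rightarrow> 'n set)"
  shows "(\<Sum>x\<in>UNIV. h x) = (\<Sum>i\<in>UNIV. \<Sum>x\<in>B i. h x)"
proof -
  have "(\<Sum>i\<in>UNIV. \<Sum>x\<in>{x \<in> UNIV. block_index B x = i}. h x) = (\<Sum>x\<in>UNIV. h x)"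
    by (rule sum.group) auto
  then show ?thesis
    by (simp add: mem_block_iff[OF assms, symmetric])
qed

text \<open>Change of variables: \<open>projected_vec \<mu> B\<close> is the image of
  \<open>\<mu>\<close> under \<open>block_index B\<close>.\<close>

lemma sum_block_index:
  assumes "block_partition B"
  shows "(\<Sum>x\<in>UNIV. \<mu> $ x * F (block_index B x))
    = (\<Sum>i\<in>UNIV. projected_vec \<mu> B $ i * (F i :: real))"
proof -
  have "(\<Sum>x\<in>B i. \<mu> $ x * F (block_index B x)) = projected_vec \<mu> B $ i * F i" for i
    by (simp add: mem_block_iff[OF assms] projected_vec_def mass_def sum_distrib_right)
  then show ?thesis by (simp add: sum_blocks[OF assms])
qed

lemma positive_projected_vec:
  assumes "positive_prob_vec \<mu>" and B: "block_partition B"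
  shows "positive_prob_vec (projected_vec \<mu> B)"
proof -
  have "0 < projected_vec \<mu> B $ i" for i
    using assms by (auto simp: projected_vec_def mass_def positive_prob_vec_def block_partition_def
        intro!: sum_pos)
  moreover have "(\<Sum>i\<in>UNIV. projected_vec \<mu> B $ i) = 1"
    using sum_block_index[OF B, of \<mu> "\<lambda>_. 1"] assms(1) by (simp add: positive_prob_vec_def)
  ultimately show ?thesis by (simp add: positive_prob_vec_def)
qed

text \<open>Block mass times projected entry is the flow from one block to another. Detailed balance
  makes the flow symmetric, and the flows out of a block add up to its mass.\<close>

lemma projected_matrix_reversible:
  assumes "positive_prob_vec \<mu>" and P: "P \<in> reversible_matrices \<mu>" and B: "block_partition B"
  shows "projected_matrix \<mu> B P \<in> reversible_matrices (projected_vec \<mu> B)"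
proof -
  have \<mu>: "0 \<le> \<mu> $ x" for x
    using assms by (auto simp: positive_prob_vec_def less_imp_le)
  have rev: "\<mu> $ x * P $ x $ y = \<mu> $ y * P $ y $ x" and P0: "0 \<le> P $ x $ y"
    and row: "(\<Sum>y\<in>UNIV. P $ x $ y) = 1" for x y
    using P by (auto simp: reversible_matrices_def transition_matrix_def)
  have m: "0 < mass \<mu> (B i)" for i
    using positive_projected_vec[OF assms(1) B] by (simp add: positive_prob_vec_def projected_vec_def)
  have "(\<Sum>j\<in>UNIV. \<Sum>x\<in>B i. \<Sum>y\<in>B j. \<mu> $ x * P $ x $ y) = mass \<mu> (B i)" for i
    by (subst sum.swap)
      (simp add: sum_blocks[OF B, symmetric] row mass_def flip: sum_distrib_left)
  then have "(\<Sum>j\<in>UNIV. projected_matrix \<mu> B P $ i $ j) = 1" for i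
    using m[of i] by (simp add: projected_matrix_def flip: sum_divide_distrib)
  moreover have "0 \<le> projected_matrix \<mu> B P $ i $ j" for i j
    using m[of i] \<mu> P0 by (auto simp: projected_matrix_def intro!: sum_nonneg divide_nonneg_pos)
  moreover have "(\<Sum>x\<in>B i. \<Sum>y\<in>B j. \<mu> $ x * P $ x $ y) = (\<Sum>x\<in>B j. \<Sum>y\<in>B i. \<mu> $ x * P $ x $ y)" for i j
    by (subst sum.swap) (simp only: rev)
  then have "projected_vec \<mu> B $ i * projected_matrix \<mu> B P $ i $ j
      = projected_vec \<mu> B $ j * projected_matrix \<mu> B P $ j $ i" for i j
    using m[of i] m[of j] by (simp add: projected_matrix_def projected_vec_def)
  ultimately show ?thesis
    by (simp add: reversible_matrices_def transition_matrix_def)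
qed

section \<open>The sandwiched kernel, its powers and its divergence\<close>

lemma gibbs_kernel_nth:
  assumes "block_partition B"
  shows "gibbs_kernel \<mu> B $ x $ y = (if block_index B y = block_index B x
    then \<mu> $ y / projected_vec \<mu> B $ block_index B x else 0)"
  unfolding gibbs_kernel_def block_of_def block_index_def[of B x, symmetric]
  by (simp add: mem_block_iff[OF assms] projected_vec_def)

text \<open>The first Gibbs step resamples the start within the block of \<open>x\<close>, and
  averaging \<open>P\<close> over it yields the projected entry. The last one redistributes the
  arrival within the block of \<open>y\<close> by conditional mass.\<close>

lemma gibbs_sandwich_nth:
  assumes B: "block_partition B"
  shows "(gibbs_kernel \<mu> B ** P ** gibbs_kernel \<mu> B) $ x $ y
    = projected_matrix \<mu> B P $ block_index B x $ block_index B y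
      * (\<mu> $ y / projected_vec \<mu> B $ block_index B y)"
proof -
  define i j where "i = block_index B x" and "j = block_index B y"
  define pb where "pb = projected_vec \<mu> B"
  have left: "(gibbs_kernel \<mu> B ** P) $ x $ v = (\<Sum>u\<in>B i. \<mu> $ u / pb $ i * P $ u $ v)" for v
  proof -
    have "(gibbs_kernel \<mu> B ** P) $ x $ v
        = (\<Sum>u\<in>UNIV. if u \<in> B i then \<mu> $ u / pb $ i * P $ u $ v else 0)"
      by (auto simp: matrix_matrix_mult_def gibbs_kernel_nth[OF B] mem_block_iff[OF B] i_def pb_def
          intro!: sum.cong)
    then show ?thesis by (simp add: sum.If_cases)
  qed
  have "(gibbs_kernel \<mu> B ** P ** gibbs_kernel \<mu> B) $ x $ y
      = (\<Sum>v\<in>UNIV. (gibbs_kernel \<mu> B ** P) $ x $ v * gibbs_kernel \<mu> B $ v $ y)"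
    by (simp add: matrix_matrix_mult_def)
  also have "\<dots> = (\<Sum>v\<in>UNIV. if v \<in> B j then (gibbs_kernel \<mu> B ** P) $ x $ v * (\<mu> $ y / pb $ j) else 0)"
    by (auto simp: gibbs_kernel_nth[OF B] mem_block_iff[OF B] j_def pb_def intro!: sum.cong)
  also have "\<dots> = (\<Sum>v\<in>B j. (\<Sum>u\<in>B i. \<mu> $ u / pb $ i * P $ u $ v) * (\<mu> $ y / pb $ j))"
    by (simp add: sum.If_cases left)
  also have "\<dots> = (\<Sum>v\<in>B j. \<Sum>u\<in>B i. \<mu> $ u / pb $ i * P $ u $ v) * (\<mu> $ y / pb $ j)"
    by (rule sum_distrib_right[symmetric])
  also have "(\<Sum>v\<in>B j. \<Sum>u\<in>B i. \<mu> $ u / pb $ i * P $ u $ v) = projected_matrix \<mu> B P $ i $ j"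
    by (subst sum.swap) (simp add: projected_matrix_def pb_def projected_vec_def sum_divide_distrib)
  finally show ?thesis by (simp add: i_def j_def pb_def)
qed

text \<open>The exponent must be positive: at exponent \<open>0\<close> the left-hand side is the identity, whereas the
  right-hand side is the Gibbs kernel.\<close>

lemma gibbs_sandwich_power_nth:
  assumes "positive_prob_vec \<mu>" and B: "block_partition B"
  shows "matrix_power (gibbs_kernel \<mu> B ** P ** gibbs_kernel \<mu> B) (Suc l) $ x $ y
    = matrix_power (projected_matrix \<mu> B P) (Suc l) $ block_index B x $ block_index B y
      * (\<mu> $ y / projected_vec \<mu> B $ block_index B y)"
proof (induction l arbitrary: x)
  case 0
  then show ?case by (simp add: gibbs_sandwich_nth[OF B])
next
  case (Suc l)
  define K where "K = gibbs_kernel \<mu> B ** P ** gibbs_kernel \<mu> B"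
  define R where "R = projected_matrix \<mu> B P"
  define pb where "pb = projected_vec \<mu> B"
  define b where "b = block_index B"
  have pb: "pb $ i \<noteq> 0" for i
    using positive_projected_vec[OF assms] by (simp add: positive_prob_vec_def less_imp_neq[symmetric] pb_def)
  have "matrix_power K (Suc (Suc l)) $ x $ y
      = (\<Sum>z\<in>UNIV. K $ x $ z * matrix_power K (Suc l) $ z $ y)"
    by (simp only: matrix_power.simps(2)[of K "Suc l"]) (simp add: matrix_matrix_mult_def)
  \<comment> \<open>Apart from the factor \<open>\<mu> $ z\<close>, the summand depends on
    \<open>z\<close> only through \<open>b z\<close>, which is the form
    \<open>sum_block_index\<close> requires.\<close>
  also have "\<dots> = (\<Sum>z\<in>UNIV. \<mu> $ z * (R $ b x $ b z / pb $ b z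
      * (matrix_power R (Suc l) $ b z $ b y * (\<mu> $ y / pb $ b y))))"
    unfolding Suc.IH[folded K_def R_def pb_def b_def] gibbs_sandwich_nth[OF B, of \<mu> P, folded K_def R_def pb_def b_def]
    by (intro sum.cong refl) (simp only: times_divide_eq_left times_divide_eq_right mult_ac)
  also have "\<dots> = (\<Sum>i\<in>UNIV. pb $ i * (R $ b x $ i / pb $ i
      * (matrix_power R (Suc l) $ i $ b y * (\<mu> $ y / pb $ b y))))"
    unfolding b_def pb_def by (rule sum_block_index[OF B])
  also have "\<dots> = (\<Sum>i\<in>UNIV. (R $ b x $ i * matrix_power R (Suc l) $ i $ b y) * (\<mu> $ y / pb $ b y))"
    using pb by (intro sum.cong refl) (simp del: matrix_power.simps)
  also have "\<dots> = matrix_power R (Suc (Suc l)) $ b x $ b y * (\<mu> $ y / pb $ b y)"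
    unfolding sum_distrib_right[symmetric]
    by (simp only: matrix_power.simps(2)[of R "Suc l"]) (simp add: matrix_matrix_mult_def)
  finally show ?case unfolding K_def R_def pb_def b_def .
qed

text \<open>The ratio of the power to the stationary mass depends only on the two blocks, so both
  sums are transported to block indices.\<close>

lemma KL_div_gibbs_sandwich_power:
  assumes pos: "positive_prob_vec \<mu>" and B: "block_partition B" and "l \<ge> 1"
  shows "KL_div \<mu> (matrix_power (gibbs_kernel \<mu> B ** P ** gibbs_kernel \<mu> B) l) (stationary_matrix \<mu>)
    = KL_div (projected_vec \<mu> B) (matrix_power (projected_matrix \<mu> B P) l)
        (stationary_matrix (projected_vec \<mu> B))"
proof -
  define K where "K = matrix_power (gibbs_kernel \<mu> B ** P ** gibbs_kernel \<mu> B) l"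
  define R where "R = matrix_power (projected_matrix \<mu> B P) l"
  define pb where "pb = projected_vec \<mu> B"
  define b where "b = block_index B"
  obtain n where l: "l = Suc n" using \<open>l \<ge> 1\<close> by (cases l) auto
  have K: "K $ x $ y = R $ b x $ b y * (\<mu> $ y / pb $ b y)" for x y
    unfolding K_def R_def pb_def b_def l by (rule gibbs_sandwich_power_nth[OF pos B])
  have \<mu>: "\<mu> $ y \<noteq> 0" for y
    using pos by (simp add: positive_prob_vec_def less_imp_neq[symmetric])
  have pb: "pb $ i \<noteq> 0" for i
    using positive_projected_vec[OF pos B] by (simp add: positive_prob_vec_def less_imp_neq[symmetric] pb_def)
  have "KL_div \<mu> K (stationary_matrix \<mu>) = (\<Sum>x\<in>UNIV. \<mu> $ x *
      (\<Sum>y\<in>UNIV. \<mu> $ y * (R $ b x $ b y / pb $ b y * ln (R $ b x $ b y / pb $ b y))))"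
    using \<mu> by (simp add: KL_div_def K stationary_matrix_def sum_distrib_left mult_ac)
  also have "\<dots> = (\<Sum>i\<in>UNIV. pb $ i *
      (\<Sum>j\<in>UNIV. pb $ j * (R $ i $ j / pb $ j * ln (R $ i $ j / pb $ j))))"
    \<comment> \<open>The inner sum over \<open>y\<close> is transported first, with the block of
      \<open>x\<close> as parameter \<open>i\<close>; the outer sum follows.\<close>
    unfolding b_def pb_def sum_block_index[OF B, of \<mu> "\<lambda>j. R $ i $ j / projected_vec \<mu> B $ j *
        ln (R $ i $ j / projected_vec \<mu> B $ j)" for i]
    by (rule sum_block_index[OF B])
  also have "\<dots> = KL_div pb R (stationary_matrix pb)"
    using pb by (simp add: KL_div_def stationary_matrix_def sum_distrib_left mult_ac)
  finally show ?thesis unfolding K_def R_def pb_def .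
qed

theorem proposition3p3:
  fixes \<pi> :: "real ^ 'x::finite"
    and P :: "real ^ 'x ^ 'x"
    and B :: "'k::finite \<Rightarrow> 'x set"
    and l :: nat
  defines "G \<equiv> gibbs_kernel \<pi> B"
    and "Pbar \<equiv> projected_matrix \<pi> B P"
    and "pibar \<equiv> projected_vec \<pi> B"
  assumes "positive_prob_vec \<pi>"
    and "P \<in> reversible_matrices \<pi>"
    and "block_partition B"
    and "CARD('k) \<ge> 2"
    and "l \<ge> 1"
  shows "KL_div \<pi> (matrix_power (G ** P ** G) l) (stationary_matrix \<pi>)
           = KL_div pibar (matrix_power Pbar l) (stationary_matrix pibar)
       \<and> KL_div pibar (matrix_power Pbar l) (stationary_matrix pibar)
           \<le> (1 - log_sobolev pibar (Pbar ** Pbar)) ^ l * shannon_entropy pibar"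
  unfolding assms(1-3)
  using KL_div_gibbs_sandwich_power[OF assms(4,6,8)]
    KL_div_power_le[OF positive_projected_vec[OF assms(4,6)]
      projected_matrix_reversible[OF assms(4-6)] assms(7)]
  by (intro conjI)

end
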